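(* For each non-negative integer $N$, $$Rt(1,1,4;N)=\begin{cases}rT(2,2,2;N)&\text{if }N\equiv0\pmod2,\\4\,rT(4,4,8;N-1)&\text{if }N\equiv1\pmod4,\\0&\text{if }N\equiv3\pmod4.\end{cases}$$
   Context: $\mathbb{N}_0=\{0,1,2,\dots\}$ and $t_n=n(n+1)/2$ (triangular numbers). For positive integers $a_1,a_2,a_3$ and $N\in\mathbb{N}_0$: $rT(a_1,a_2,a_3;N)=|\{(l,m,n)\in\mathbb{Z}\times\mathbb{N}_0^2: N=a_1l^2+a_2t_m+a_3t_n\}|$; $Rt(a_1,a_2,a_3;N)=|\{(l,m,n)\in\mathbb{Z}^2\times\mathbb{N}_0: N=a_1l^2+a_2m^2+a_3t_n\}|$. *)

theory Defs
  imports Main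
begin

definition tri :: "nat \<Rightarrow> nat" where
  "tri n = n * (n + 1) div 2"

(* For positive coefficients the sets below are finite, so card is the true
   number of representations. *)

definition rT :: "nat \<Rightarrow> nat \<Rightarrow> nat \<Rightarrow> nat \<Rightarrow> nat" where
  "rT a1 a2 a3 N =
     card {(l :: int, m :: nat, n :: nat).
       int N = int a1 * l^2 + int a2 * int (tri m) + int a3 * int (tri n)}"

definition Rt :: "nat \<Rightarrow> nat \<Rightarrow> nat \<Rightarrow> nat \<Rightarrow> nat" where
  "Rt a1 a2 a3 N =
     card {(l :: int, m :: int, n :: nat).
       int N = int a1 * l^2 + int a2 * m^2 + int a3 * int (tri n)}"

end

theory Submission
  imports Defs
begin

text \<open>
  If \<open>N\<close> is even, then \<open>l\<close> and \<open>m\<close> have the same parity, and the substitution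
  \<open>l = x + y\<close>, \<open>m = x - y\<close> turns \<open>l\<^sup>2 + m\<^sup>2 + 4 t\<^sub>k\<close> into \<open>2 (x\<^sup>2 + y\<^sup>2 + 2 t\<^sub>k)\<close>.
  It remains to compare \<open>y\<^sup>2 + 2 t\<^sub>k\<close> with \<open>t\<^sub>m + t\<^sub>n\<close>.  From
  \<open>4 (t\<^sub>m + t\<^sub>n) + 1 = (m + n + 1)\<^sup>2 + (m - n)\<^sup>2\<close> and
  \<open>4 (y\<^sup>2 + 2 t\<^sub>k) + 1 = (2 y)\<^sup>2 + (2 k + 1)\<^sup>2\<close> one reads off a bijection between the
  pairs \<open>(y, k)\<close> and \<open>(m, n)\<close>: match the even and the odd square on both sides.
  If \<open>N\<close> is odd, then one of \<open>l\<close>, \<open>m\<close> is \<open>2 a\<close> and the other is \<open>\<plusminus>(2 b + 1)\<close> with \<open>b \<ge> 0\<close>;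
  the choice of the position and of the sign yields the factor 4.
\<close>

lemma double_int_tri: "2 * int (tri n) = int n * (int n + 1)"
proof -
  have "2 * tri n = n * (n + 1)"
    unfolding tri_def by simp
  then show ?thesis
    by (metis of_nat_1 of_nat_add of_nat_mult of_nat_numeral)
qed

text \<open>The three branches solve for \<open>m\<close>, \<open>n\<close>: if
  \<open>\<bar>y\<bar> \<le> k\<close> then \<open>m + n + 1 = 2 * k + 1\<close> and
  \<open>m - n = 2 * y\<close>; otherwise \<open>m + n + 1 = 2 * \<bar>y\<bar>\<close> and
  \<open>m - n\<close> is \<open>2 * k + 1\<close> with the sign of \<open>y\<close>. Each argument
  of \<open>nat\<close> is nonnegative on its branch.\<close>

fun tri_pair :: "int \<times> nat \<Rightarrow> nat \<times> nat" where
  "tri_pair (y, k) =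
     (if \<bar>y\<bar> \<le> int k then (nat (int k + y), nat (int k - y))
      else if 0 < y then (nat (y + int k), nat (y - int k - 1))
      else (nat (- y - int k - 1), nat (int k - y)))"

text \<open>The parity of \<open>m + n\<close> tells which of \<open>m + n + 1\<close> and
  \<open>m - n\<close> is the odd root. If it is \<open>m - n\<close>, then
  \<open>m \<noteq> n\<close>, and the order of \<open>m\<close> and \<open>n\<close> gives the sign
  of \<open>y\<close>.\<close>

fun tri_pair_inv :: "nat \<times> nat \<Rightarrow> int \<times> nat" where
  "tri_pair_inv (m, n) =
     (if even (m + n) then ((int m - int n) div 2, (m + n) div 2)
      else if n < m then ((int m + int n + 1) div 2, (m - n - 1) div 2)
      else (- ((int m + int n + 1) div 2), (n - m - 1) div 2))"

lemma tri_pair_inv_left: "tri_pair_inv (tri_pair (y, k)) = (y, k)"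
proof -
  \<comment> \<open>Natural parameters for the gaps between \<open>\<bar>y\<bar>\<close> and
    \<open>k\<close> resolve the branch conditions and turn every \<open>nat\<close> into a plain
    sum.\<close>
  consider j d where "y = int j" "k = j + d" | j d where "y = - int j" "k = j + d"
    | a where "y = int k + 1 + int a" | a where "y = - int k - 1 - int a"
  proof -
    have "y = int (nat y) \<and> k = nat y + (k - nat y)" if "0 \<le> y" "y \<le> int k"
      using that by simp
    moreover have "y = - int (nat (- y)) \<and> k = nat (- y) + (k - nat (- y))"
      if "y \<le> 0" "- y \<le> int k"
      using that by simp
    moreover have "y = int k + 1 + int (nat (y - int k - 1))" if "int k < y"
      using that by simp
    moreover have "y = - int k - 1 - int (nat (- y - int k - 1))" if "int k < - y"
      using that by simp
    ultimately show thesis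
      using that by (metis linorder_not_less linorder_linear)
  qed
  then show ?thesis
  proof cases
    case 1
    then have "tri_pair (y, k) = (2 * j + d, d)" by auto
    then show ?thesis using 1 by simp
  next
    case 2
    then have "tri_pair (y, k) = (d, 2 * j + d)" by auto
    then show ?thesis using 2 by simp
  next
    case 3
    then have "tri_pair (y, k) = (2 * k + a + 1, a)" by auto
    then show ?thesis using 3 by simp
  next
    case 4
    then have "tri_pair (y, k) = (a, 2 * k + a + 1)" by auto
    then show ?thesis using 4 by simp
  qed
qed

lemma tri_pair_inv_right: "tri_pair (tri_pair_inv (m, n)) = (m, n)"
proof -
  obtain e where "m = n + e \<or> n = m + e"
    by (metis le_iff_add nat_le_linear)
  \<comment> \<open>The difference of \<open>m\<close> and \<open>n\<close> has the parity of their
    sum, so these cases follow the branches of \<open>tri_pair_inv\<close>.\<close>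
  then consider d where "m = n + 2 * d" | d where "n = m + 2 * d"
    | d where "m = n + 2 * d + 1" | d where "n = m + 2 * d + 1"
    by (cases "even e") (auto elim!: evenE oddE)
  then show ?thesis
  proof cases
    case 1
    then have "tri_pair_inv (m, n) = (int d, n + d)" by simp
    then show ?thesis using 1 by simp
  next
    case 2
    then have "tri_pair_inv (m, n) = (- int d, m + d)" by simp
    then show ?thesis using 2 by simp
  next
    case 3
    then have "tri_pair_inv (m, n) = (int n + int d + 1, d)" by simp
    then show ?thesis using 3 by simp
  next
    case 4
    then have "tri_pair_inv (m, n) = (- (int m + int d + 1), d)" by simp
    then show ?thesis using 4 by simp
  qed
qed

lemma bij_tri_pair: "bij tri_pair"
  by (rule o_bij[of tri_pair_inv])
     (simp_all only: fun_eq_iff split_paired_all o_apply id_apply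
        tri_pair_inv_left tri_pair_inv_right simp_thms split_paired_All)

lemma tri_pair_sum:
  assumes "tri_pair (y, k) = (m, n)"
  shows "int (tri m) + int (tri n) = y\<^sup>2 + 2 * int (tri k)"
proof -
  \<comment> \<open>Doubling removes the division in \<open>tri\<close> and leaves a polynomial
    identity on each branch.\<close>
  have "2 * int (tri m) + 2 * int (tri n) = 2 * y\<^sup>2 + 2 * (2 * int (tri k))"
    unfolding double_int_tri using assms
    by (auto simp: power2_eq_square algebra_simps split: if_splits)
  then show ?thesis by simp
qed

lemma Rt_1_1_4_even:
  assumes "even N"
  shows "Rt 1 1 4 N = rT 2 2 2 N"
proof -
  define A where "A = {(l, m, k). int N = l\<^sup>2 + m\<^sup>2 + 4 * int (tri k)}"
  define B where "B = {(x, y, k). int N = 2 * x\<^sup>2 + 2 * y\<^sup>2 + 4 * int (tri k)}"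
  define C where "C = {(x, m, n). int N = 2 * x\<^sup>2 + 2 * int (tri m) + 2 * int (tri n)}"
  define f :: "int \<times> int \<times> nat \<Rightarrow> int \<times> int \<times> nat"
    where "f = (\<lambda>(x, y, k). (x + y, x - y, k))"
  define g :: "int \<times> int \<times> nat \<Rightarrow> int \<times> nat \<times> nat" where "g = map_prod id tri_pair"
  have "f ` B = A"
  proof
    show "f ` B \<subseteq> A"
      by (auto simp: A_def B_def f_def power2_eq_square algebra_simps)
    show "A \<subseteq> f ` B"
    proof
      fix p assume "p \<in> A"
      then obtain l m k where p: "p = (l, m, k)"
        and N: "int N = l\<^sup>2 + m\<^sup>2 + 4 * int (tri k)"
        by (auto simp: A_def)
      have "even (int N)" using assms by simp
      then have "even (l + m)" unfolding N by simp
      then obtain x where x: "l + m = 2 * x" by (elim evenE)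
      \<comment> \<open>Here \<open>x\<close> is half the sum of \<open>l\<close> and
        \<open>m\<close>, so \<open>y\<close> is half their difference.\<close>
      define y where "y = x - m"
      have lm: "l = x + y" "m = x - y" using x by (auto simp: y_def)
      have "(x, y, k) \<in> B"
        using N by (simp add: B_def lm power2_eq_square algebra_simps)
      then show "p \<in> f ` B"
        by (force simp: p f_def lm)
    qed
  qed
  moreover have "inj_on f B"
    by (auto simp: inj_on_def f_def)
  ultimately have AB: "card A = card B"
    using card_image by blast
  have "bij g"
    unfolding g_def using bij_tri_pair bij_id by (simp add: bij_def map_prod_surj prod.inj_map)
  moreover have "p \<in> B \<longleftrightarrow> g p \<in> C" for p
  proof -
    obtain x y k where p: "p = (x, y, k)" by (cases p)
    obtain m n where mn: "tri_pair (y, k) = (m, n)" by (cases "tri_pair (y, k)")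
    show ?thesis
      using tri_pair_sum[OF mn] by (auto simp: p B_def C_def g_def mn simp del: tri_pair.simps)
  qed
  \<comment> \<open>As \<open>g\<close> is a bijection between the full types, a preimage under it
    has the same cardinality.\<close>
  then have "B = g -` C" by auto
  ultimately have "card B = card C"
    by (simp add: card_vimage_inj bij_def)
  with AB show ?thesis
    by (simp add: Rt_def rT_def A_def C_def)
qed

lemma Rt_1_1_4_odd:
  assumes "odd N"
  shows "Rt 1 1 4 N = 4 * rT 4 4 8 (N - 1)"
proof -
  define A where "A = {(l, m, k). int N = l\<^sup>2 + m\<^sup>2 + 4 * int (tri k)}"
  define B where "B = {(a, k, b). int (N - 1) = 4 * a\<^sup>2 + 4 * int (tri k) + 8 * int (tri b)}"
  \<comment> \<open>The two Booleans record the position and the sign of the odd entry.\<close>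
  define f :: "bool \<times> bool \<times> int \<times> nat \<times> nat \<Rightarrow> int \<times> int \<times> nat"
    where "f = (\<lambda>(swap, sign, a, k, b).
      let u = (if sign then - (2 * int b + 1) else 2 * int b + 1)
      in if swap then (u, 2 * a, k) else (2 * a, u, k))"
  have N1: "int (N - 1) = int N - 1"
    using assms by (cases N) auto
  \<comment> \<open>This is the source of both the coefficient 8 and the shift to
    \<open>N - 1\<close>.\<close>
  have odd_sq: "(2 * int b + 1)\<^sup>2 = 8 * int (tri b) + 1" for b
    using double_int_tri[of b] by (simp add: power2_eq_square algebra_simps)
  have "f ` (UNIV \<times> UNIV \<times> B) = A"
  proof
    show "f ` (UNIV \<times> UNIV \<times> B) \<subseteq> A"
      unfolding A_def B_def f_def Let_def
      by (auto simp: N1 odd_sq power_mult_distrib split: if_splits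
          simp del: minus_add_distrib One_nat_def)
    show "A \<subseteq> f ` (UNIV \<times> UNIV \<times> B)"
    proof
      fix p assume "p \<in> A"
      then obtain l m k where p: "p = (l, m, k)"
        and N: "int N = l\<^sup>2 + m\<^sup>2 + 4 * int (tri k)"
        by (auto simp: A_def)
      have "odd (int N)" using assms by simp
      then have parity: "odd (l + m)" unfolding N by simp
      define e where "e = (if even l then l else m)"
      define u where "u = (if even l then m else l)"
      have "even e" "odd u"
        using parity by (auto simp: e_def u_def)
      then obtain a where e: "e = 2 * a" by (elim evenE)
      \<comment> \<open>Passing to the absolute value makes \<open>c\<close> nonnegative, hence a
        natural number \<open>b\<close>.\<close>
      have "odd \<bar>u\<bar>" using \<open>odd u\<close> by simp
      then obtain c where c: "\<bar>u\<bar> = 2 * c + 1" by (elim oddE)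
      then have "0 \<le> c" by linarith
      then obtain b where b: "\<bar>u\<bar> = 2 * int b + 1"
        using c nonneg_int_cases by metis
      have "int N = e\<^sup>2 + \<bar>u\<bar>\<^sup>2 + 4 * int (tri k)"
        using N by (auto simp: e_def u_def)
      then have "(a, k, b) \<in> B"
        by (simp add: B_def N1 e b odd_sq power_mult_distrib del: One_nat_def)
      moreover have "p = f (odd l, u < 0, a, k, b)"
        using e b by (auto simp: p f_def Let_def e_def u_def split: if_splits)
      ultimately show "p \<in> f ` (UNIV \<times> UNIV \<times> B)"
        by blast
    qed
  qed
  moreover have "inj f"
    \<comment> \<open>The left inverse reads the position off the parity of \<open>l\<close> and the
      sign off \<open>u\<close>, which is odd and so nonzero; \<open>\<bar>u\<bar> div 2\<close>
      returns \<open>b\<close>.\<close>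
    by (rule inj_on_inverseI[where g = "\<lambda>(l, m, k).
          let e = (if even l then l else m); u = (if even l then m else l)
          in (odd l, u < 0, e div 2, k, nat (\<bar>u\<bar> div 2))"])
       (auto simp: f_def Let_def)
  then have "inj_on f (UNIV \<times> UNIV \<times> B)"
    by (rule inj_on_subset) simp
  ultimately have "card A = card ((UNIV :: bool set) \<times> (UNIV :: bool set) \<times> B)"
    using card_image by metis
  also have "\<dots> = 4 * card B"
    by (simp add: card_cartesian_product)
  finally show ?thesis
    by (simp add: Rt_def rT_def A_def B_def)
qed

text \<open>Squares are 0 or 1 modulo 4, so two of them never add up to 3 modulo 4.\<close>

lemma Rt_1_1_4_eq_0:
  assumes "N mod 4 = 3"
  shows "Rt 1 1 4 N = 0"
proof -
  have "int N \<noteq> l\<^sup>2 + m\<^sup>2 + 4 * int (tri k)" for l m :: int and k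
  proof
    have sq: "x\<^sup>2 mod 4 = 0 \<or> x\<^sup>2 mod 4 = 1" for x :: int
    proof -
      obtain b where "x = 2 * b \<or> x = 2 * b + 1"
        by (metis evenE oddE)
      then have "x\<^sup>2 = 4 * (b * b) \<or> x\<^sup>2 = 4 * (b * b + b) + 1"
        by (auto simp: power2_eq_square algebra_simps)
      then show ?thesis by presburger
    qed
    assume "int N = l\<^sup>2 + m\<^sup>2 + 4 * int (tri k)"
    moreover have "int N mod 4 = 3"
      using assms by presburger
    ultimately show False
      using sq[of l] sq[of m] by presburger
  qed
  then show ?thesis
    by (simp add: Rt_def case_prod_unfold)
qed

theorem theorem5p4:
  fixes N :: nat
  shows "(N mod 2 = 0 \<longrightarrow> Rt 1 1 4 N = rT 2 2 2 N) \<and>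
         (N mod 4 = 1 \<longrightarrow> Rt 1 1 4 N = 4 * rT 4 4 8 (N - 1)) \<and>
         (N mod 4 = 3 \<longrightarrow> Rt 1 1 4 N = 0)"
proof (intro conjI impI)
  assume "N mod 2 = 0"
  then show "Rt 1 1 4 N = rT 2 2 2 N"
    by (intro Rt_1_1_4_even) presburger
next
  assume "N mod 4 = 1"
  then show "Rt 1 1 4 N = 4 * rT 4 4 8 (N - 1)"
    by (intro Rt_1_1_4_odd) presburger
qed (rule Rt_1_1_4_eq_0)

end
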